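(* Let $\mathcal{X}_0,\mathcal{X}_1,\mathcal{X}_2$ be finite sets with $|\mathcal{X}_i|=n_i$, identified with $\{1,\dots,n_i\}$, let $\alpha_1,\dots,\alpha_{n_0}>0$ with $\sum_{j=1}^{n_0}\alpha_j=1$, and let $w\in\mathbb{R}^{n_0n_1n_2}$ be a payoff vector. Consider the optimization problem $$ \begin{array}{cl} \min_q & -\sum_{(x_0,x_1,x_2)} q(x_0,x_1,x_2)\,w(x_0,x_1,x_2)\\ \text{s.t.} & -1+\sum_{(x_0,x_1,x_2)} q(x_0,x_1,x_2)=0,\\ & -\alpha_{x_0}+\sum_{(x_1,x_2)} q(x_0,x_1,x_2)=0\quad \forall x_0\in\mathcal{X}_0,\\ & -q(x_0,x_1,x_2)\le 0\quad \forall (x_0,x_1,x_2)\in\mathcal{X}_0\times\mathcal{X}_1\times\mathcal{X}_2,\\ & ic(q):=I_q(X_0;X_2)-H_q(X_1|X_0,X_2)\le 0. \end{array} $$ If there exists a permutation such that the payoff vector $w$ can be strictly ordered (i.e. the components of $w$ are pairwise distinct), then any optimal solution of this problem is such that the information-theoretic constraint $ic(q)\le 0$ is active, i.e. its multiplier $\lambda_{\mathrm{IC}}$ in the Karush–Kuhn–Tucker conditions satisfies $\lambda_{\mathrm{IC}}>0$.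
   Context: For a joint distribution $q$ of $(X_0,X_1,X_2)$, $H_q$ and $I_q$ denote (conditional) Shannon entropy and mutual information computed under $q$, with base-2 logarithms and the convention $0\log_2 0=0$: $H_q(X|Y)=-\sum_{x,y}q(x,y)\log_2\frac{q(x,y)}{q_Y(y)}$ and $I_q(X;Y)=\sum_{x,y}q(x,y)\log_2\frac{q(x,y)}{q_X(x)q_Y(y)}$. Equivalently, $ic(q)=H_q(X_0)+H_q(X_2)-H_q(X_0,X_1,X_2)$. The numbers $\alpha_j=\Pr[X_0=j]$ are the fixed law of a random state $X_0$; $w$ is indexed by the triples $(x_0,x_1,x_2)$. The Lagrangian of the problem is $$\mathcal{L}=-\sum_{x}(w(x)+\lambda_x)q(x)+\mu_0\Big[\sum_x q(x)-1\Big]+\sum_{x_0}\mu_{x_0}\Big[\sum_{x_1,x_2}q(x_0,x_1,x_2)-\alpha_{x_0}\Big]+\lambda_{\mathrm{IC}}\,ic(q),$$ where $x=(x_0,x_1,x_2)$ ranges over $\mathcal{X}_0\times\mathcal{X}_1\times\mathcal{X}_2$, $\lambda_x$ is the multiplier of $-q(x)\le 0$, $\mu_0$ that of the normalization constraint, $\mu_{x_0}$ (for $x_0\in\mathcal{X}_0$; distinct from $\mu_0$) that of the marginal constraint, and $\lambda_{\mathrm{IC}}$ that of the information constraint. The Karush–Kuhn–Tucker conditions are: $\partial\mathcal{L}/\partial q(x)=0$ for all $x$; $\lambda_x\ge 0$ for all $x$; $\lambda_{\mathrm{IC}}\ge 0$; $\lambda_x q(x)=0$ for all $x$; $\lamb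da_{\mathrm{IC}}\,ic(q)=0$.
   Formalization: Added: n_1≥2, or no single x_2 is part of the best (x_1,x_2) for every x_0; and the KKT conditions include existence of the (one-sided at 0) partial derivatives of ic at q. Otherwise λ_IC=0 can satisfy the KKT conditions at an optimum, e.g. when n_1=n_2=1. *)

theory Defs
  imports Complex_Main "HOL-Library.Cardinality"
begin

text \<open>
  A joint law on finite alphabets is a real-valued function on the corresponding tuples. The
  functionals below are defined for arbitrary such functions and not only for probability
  vectors, because the Lagrangian is differentiated in one coordinate at a time, which leaves the
  probability simplex. The convention \<open>0 log 0 = 0\<close> holds automatically, since \<open>0 * x = 0\<close>.
\<close>

text \<open>\<open>cond_entropy p\<close> is \<open>H(X | Y)\<close> for \<open>(X, Y)\<close> with joint law \<open>p\<close>.\<close>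

definition cond_entropy :: "('x::finite \<times> 'y::finite \<Rightarrow> real) \<Rightarrow> real" where
  "cond_entropy p =
     - (\<Sum>x\<in>UNIV. \<Sum>y\<in>UNIV. p (x, y) * log 2 (p (x, y) / (\<Sum>x'\<in>UNIV. p (x', y))))"

definition mutual_info :: "('x::finite \<times> 'y::finite \<Rightarrow> real) \<Rightarrow> real" where
  "mutual_info p =
     (\<Sum>x\<in>UNIV. \<Sum>y\<in>UNIV. p (x, y) *
        log 2 (p (x, y) / ((\<Sum>y'\<in>UNIV. p (x, y')) * (\<Sum>x'\<in>UNIV. p (x', y)))))"

text \<open>\<open>I(X\<^sub>0; X\<^sub>2) - H(X\<^sub>1 | X\<^sub>0, X\<^sub>2)\<close>\<close>

definition ic :: "('a::finite \<times> 'b::finite \<times> 'c::finite \<Rightarrow> real) \<Rightarrow> real" where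
  "ic q = mutual_info (\<lambda>(x0, x2). \<Sum>x1\<in>UNIV. q (x0, x1, x2))
          - cond_entropy (\<lambda>(x1, (x0, x2)). q (x0, x1, x2))"

definition cost ::
  "('a::finite \<times> 'b::finite \<times> 'c::finite \<Rightarrow> real) \<Rightarrow> ('a \<times> 'b \<times> 'c \<Rightarrow> real) \<Rightarrow> real" where
  "cost w q = - (\<Sum>x\<in>UNIV. q x * w x)"

definition feasible ::
  "('a::finite \<Rightarrow> real) \<Rightarrow> ('a \<times> 'b::finite \<times> 'c::finite \<Rightarrow> real) \<Rightarrow> bool" where
  "feasible \<alpha> q \<longleftrightarrow>
     - 1 + (\<Sum>x\<in>UNIV. q x) = 0 \<and>
     (\<forall>x0. - \<alpha> x0 + (\<Sum>x1\<in>UNIV. \<Sum>x2\<in>UNIV. q (x0, x1, x2)) = 0) \<and>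
     (\<forall>x. - q x \<le> 0) \<and>
     ic q \<le> 0"

definition optimal ::
  "('a::finite \<Rightarrow> real) \<Rightarrow> ('a \<times> 'b::finite \<times> 'c::finite \<Rightarrow> real) \<Rightarrow>
   ('a \<times> 'b \<times> 'c \<Rightarrow> real) \<Rightarrow> bool" where
  "optimal \<alpha> w q \<longleftrightarrow> is_arg_min (cost w) (feasible \<alpha>) q"

definition lagrangian ::
  "('a::finite \<Rightarrow> real) \<Rightarrow> ('a \<times> 'b::finite \<times> 'c::finite \<Rightarrow> real) \<Rightarrow>
   ('a \<times> 'b \<times> 'c \<Rightarrow> real) \<Rightarrow> real \<Rightarrow> ('a \<Rightarrow> real) \<Rightarrow> real \<Rightarrow>
   ('a \<times> 'b \<times> 'c \<Rightarrow> real) \<Rightarrow> real" where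
  "lagrangian \<alpha> w l \<mu>0 \<mu> l_ic q =
     - (\<Sum>x\<in>UNIV. (w x + l x) * q x)
     + \<mu>0 * ((\<Sum>x\<in>UNIV. q x) - 1)
     + (\<Sum>x0\<in>UNIV. \<mu> x0 * ((\<Sum>x1\<in>UNIV. \<Sum>x2\<in>UNIV. q (x0, x1, x2)) - \<alpha> x0))
     + l_ic * ic q"

text \<open>
  Partial derivatives are taken on the domain \<open>q x \<ge> 0\<close> where the information functionals are
  meaningful, hence they are one-sided when \<open>q x = 0\<close>. The first clause is the differentiability
  of the constraint function that the stationarity condition presupposes; it follows from the
  second clause when \<open>l_ic \<noteq> 0\<close>. On the feasible set it fails exactly when \<open>q (x0, x1, x2) = 0\<close>
  for some triple with \<open>Pr[X\<^sub>2 = x2] > 0\<close>, where the derivative of the entropy term is infinite;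
  without it, \<open>l_ic = 0\<close> would silently erase such infinite entries of the gradient.
\<close>

definition kkt ::
  "('a::finite \<Rightarrow> real) \<Rightarrow> ('a \<times> 'b::finite \<times> 'c::finite \<Rightarrow> real) \<Rightarrow>
   ('a \<times> 'b \<times> 'c \<Rightarrow> real) \<Rightarrow>
   ('a \<times> 'b \<times> 'c \<Rightarrow> real) \<Rightarrow> real \<Rightarrow> ('a \<Rightarrow> real) \<Rightarrow> real \<Rightarrow> bool" where
  "kkt \<alpha> w q l \<mu>0 \<mu> l_ic \<longleftrightarrow>
     (\<forall>x. (\<lambda>t. ic (q(x := t))) differentiable (at (q x) within {0..})) \<and>
     (\<forall>x. ((\<lambda>t. lagrangian \<alpha> w l \<mu>0 \<mu> l_ic (q(x := t))) has_real_derivative 0)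
            (at (q x) within {0..})) \<and>
     (\<forall>x. l x \<ge> 0) \<and>
     l_ic \<ge> 0 \<and>
     (\<forall>x. l x * q x = 0) \<and>
     l_ic * ic q = 0"

end

theory Submission
  imports Defs "HOL-Real_Asymp.Real_Asymp"
begin

text \<open>
  For nonnegative \<open>q\<close> the function \<open>ic\<close> equals
  \<open>\<Sum> h(q x) - \<Sum> h(q\<^sub>0 x0) - \<Sum> h(q\<^sub>2 x2)\<close> with \<open>h u = u log u\<close>. If \<open>ic q < 0\<close> at an optimum, moving
  slightly towards the solution of the linear program without the information constraint stays
  feasible, so \<open>q\<close> is itself that solution. Since \<open>w\<close> is injective, it puts all mass of each
  \<open>x0\<close> on the unique maximiser of \<open>w (x0, _)\<close>, whence \<open>ic q = H(X\<^sub>2) \<ge> 0\<close>, a contradiction.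
  If \<open>l_ic = 0\<close>, the stationarity conditions are those of the linear program, and \<open>q\<close> is again
  concentrated on the maximisers. By nondegeneracy there is then a triple of mass \<open>0\<close> with
  \<open>q\<^sub>2 x2 > 0\<close>, and in its direction the derivative of \<open>ic\<close> is \<open>-\<infinity>\<close>.
\<close>

section \<open>Marginals and the function \<open>u log u\<close>\<close>

definition xlogx :: "real \<Rightarrow> real" where
  "xlogx u = u * log 2 u"

definition marg0 :: "('a \<times> 'b::finite \<times> 'c::finite \<Rightarrow> real) \<Rightarrow> 'a \<Rightarrow> real" where
  "marg0 q x0 = (\<Sum>y\<in>UNIV. q (x0, y))"

definition marg2 :: "('a::finite \<times> 'b::finite \<times> 'c \<Rightarrow> real) \<Rightarrow> 'c \<Rightarrow> real" where
  "marg2 q x2 = (\<Sum>x0\<in>UNIV. \<Sum>x1\<in>UNIV. q (x0, x1, x2))"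

lemma sum_UNIV_prod:
  fixes f :: "'x::finite \<times> 'y::finite \<Rightarrow> real"
  shows "(\<Sum>z\<in>UNIV. f z) = (\<Sum>x\<in>UNIV. \<Sum>y\<in>UNIV. f (x, y))"
  by (simp add: sum.cartesian_product flip: UNIV_Times_UNIV)

lemma marg0_eq: "marg0 q x0 = (\<Sum>x1\<in>UNIV. \<Sum>x2\<in>UNIV. q (x0, x1, x2))"
  by (simp add: marg0_def sum_UNIV_prod)

lemma sum_marg0:
  fixes q :: "'a::finite \<times> 'b::finite \<times> 'c::finite \<Rightarrow> real"
  shows "(\<Sum>x0\<in>UNIV. marg0 q x0) = (\<Sum>x\<in>UNIV. q x)"
  by (simp add: marg0_def sum_UNIV_prod)

lemma sum_marg2:
  fixes q :: "'a::finite \<times> 'b::finite \<times> 'c::finite \<Rightarrow> real"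
  shows "(\<Sum>x2\<in>UNIV. marg2 q x2) = (\<Sum>x\<in>UNIV. q x)"
proof -
  have "(\<Sum>x2\<in>UNIV. marg2 q x2) = (\<Sum>x0\<in>UNIV. \<Sum>x2\<in>UNIV. \<Sum>x1\<in>UNIV. q (x0, x1, x2))"
    unfolding marg2_def by (rule sum.swap)
  also have "\<dots> = (\<Sum>x0\<in>UNIV. \<Sum>x1\<in>UNIV. \<Sum>x2\<in>UNIV. q (x0, x1, x2))"
    by (intro sum.cong refl sum.swap)
  finally show ?thesis by (simp add: sum_UNIV_prod)
qed

lemma feasible_iff:
  "feasible \<alpha> q \<longleftrightarrow> (\<Sum>x\<in>UNIV. q x) = 1 \<and> marg0 q = \<alpha> \<and> (\<forall>x. q x \<ge> 0) \<and> ic q \<le> 0"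
  by (auto simp: feasible_def fun_eq_iff algebra_simps simp flip: marg0_eq)

text \<open>Only the origin is delicate: there \<open>u log u\<close> tends to 0, which agrees with
  the value given by \<open>0 * x = 0\<close>.\<close>

lemma continuous_on_xlogx: "continuous_on {0..} xlogx"
proof (rule continuous_on_eq_continuous_within[THEN iffD2], rule ballI)
  fix x :: real
  assume x: "x \<in> {0..}"
  show "continuous (at x within {0..}) xlogx"
  proof (cases "x = 0")
    case True
    have "((\<lambda>u::real. u * log 2 u) \<longlongrightarrow> 0) (at_right 0)"
      by real_asymp
    then show ?thesis
      using True by (simp add: continuous_within xlogx_def[abs_def] at_within_Ici_at_right)
  next
    case False
    then have "isCont (\<lambda>u. u * log 2 u) x"
      using x by (intro continuous_intros) auto
    then show ?thesis
      unfolding xlogx_def[abs_def] by (rule continuous_at_imp_continuous_at_within)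
  qed
qed

lemma xlogx_nonpos: "0 \<le> u \<Longrightarrow> u \<le> 1 \<Longrightarrow> xlogx u \<le> 0"
  by (cases "u = 0") (auto simp: xlogx_def mult_le_0_iff)

section \<open>Information functionals as sums of \<open>xlogx\<close>\<close>

text \<open>By nonnegativity each entry is at most its two marginals. So at a nonzero entry both
  marginals are positive and the logarithm of the quotient splits; a zero entry contributes 0 to
  every term.\<close>

lemma mutual_info_eq:
  fixes p :: "'x::finite \<times> 'y::finite \<Rightarrow> real"
  assumes nonneg: "\<And>z. p z \<ge> 0"
  shows "mutual_info p = (\<Sum>x\<in>UNIV. \<Sum>y\<in>UNIV. xlogx (p (x, y)))
    - (\<Sum>x\<in>UNIV. xlogx (\<Sum>y\<in>UNIV. p (x, y))) - (\<Sum>y\<in>UNIV. xlogx (\<Sum>x\<in>UNIV. p (x, y)))"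
proof -
  define r where "r x = (\<Sum>y\<in>UNIV. p (x, y))" for x
  define s where "s y = (\<Sum>x\<in>UNIV. p (x, y))" for y
  have le: "p (x, y) \<le> r x" "p (x, y) \<le> s y" for x y
    unfolding r_def s_def using nonneg
    by (intro member_le_sum[of y UNIV "\<lambda>y. p (x, y)"] member_le_sum[of x UNIV "\<lambda>x. p (x, y)"]; simp)+
  have pt: "p (x, y) * log 2 (p (x, y) / (r x * s y))
      = xlogx (p (x, y)) - p (x, y) * log 2 (r x) - p (x, y) * log 2 (s y)" for x y
  proof (cases "p (x, y) = 0")
    case False
    then have "p (x, y) > 0" using nonneg[of "(x, y)"] by simp
    moreover from this have "r x > 0" "s y > 0" using le[of x y] by linarith+
    ultimately show ?thesis
      by (simp add: log_divide log_mult xlogx_def algebra_simps)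
  qed (simp add: xlogx_def)
  have "(\<Sum>x\<in>UNIV. \<Sum>y\<in>UNIV. p (x, y) * log 2 (s y)) = (\<Sum>y\<in>UNIV. xlogx (s y))"
    by (subst sum.swap) (simp add: s_def xlogx_def sum_distrib_right)
  moreover have "(\<Sum>x\<in>UNIV. \<Sum>y\<in>UNIV. p (x, y) * log 2 (r x)) = (\<Sum>x\<in>UNIV. xlogx (r x))"
    by (simp add: r_def xlogx_def sum_distrib_right)
  ultimately show ?thesis
    unfolding mutual_info_def
    by (simp add: pt sum_subtractf flip: r_def s_def)
qed

lemma cond_entropy_eq:
  fixes p :: "'x::finite \<times> 'y::finite \<Rightarrow> real"
  assumes nonneg: "\<And>z. p z \<ge> 0"
  shows "cond_entropy p = (\<Sum>y\<in>UNIV. xlogx (\<Sum>x\<in>UNIV. p (x, y)))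
    - (\<Sum>x\<in>UNIV. \<Sum>y\<in>UNIV. xlogx (p (x, y)))"
proof -
  define s where "s y = (\<Sum>x\<in>UNIV. p (x, y))" for y
  have le: "p (x, y) \<le> s y" for x y
    unfolding s_def using nonneg by (intro member_le_sum[of x UNIV "\<lambda>x. p (x, y)"]) auto
  have pt: "p (x, y) * log 2 (p (x, y) / s y) = xlogx (p (x, y)) - p (x, y) * log 2 (s y)" for x y
  proof (cases "p (x, y) = 0")
    case False
    then have "p (x, y) > 0" using nonneg[of "(x, y)"] by simp
    moreover from this have "s y > 0" using le[of x y] by linarith
    ultimately show ?thesis
      by (simp add: log_divide xlogx_def algebra_simps)
  qed (simp add: xlogx_def)
  have "(\<Sum>x\<in>UNIV. \<Sum>y\<in>UNIV. p (x, y) * log 2 (s y)) = (\<Sum>y\<in>UNIV. xlogx (s y))"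
    by (subst sum.swap) (simp add: s_def xlogx_def sum_distrib_right)
  then show ?thesis
    unfolding cond_entropy_def
    by (simp add: pt sum_subtractf flip: s_def)
qed

text \<open>The terms of the law of (X0, X2) occur in both the mutual information and the
  conditional entropy and cancel. What remains is H(X0) + H(X2) - H(X0, X1, X2) on laws, a form from
  which continuity and one-sided derivatives can be read off.\<close>

lemma ic_eq:
  assumes nonneg: "\<And>x. q x \<ge> 0"
  shows "ic q = (\<Sum>x\<in>UNIV. xlogx (q x)) - (\<Sum>x0\<in>UNIV. xlogx (marg0 q x0))
    - (\<Sum>x2\<in>UNIV. xlogx (marg2 q x2))"
proof -
  let ?p = "\<lambda>(x0, x2). \<Sum>x1\<in>UNIV. q (x0, x1, x2)"
  let ?r = "\<lambda>(x1, x0, x2). q (x0, x1, x2)"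
  have *: "marg0 q x0 = (\<Sum>x2\<in>UNIV. \<Sum>x1\<in>UNIV. q (x0, x1, x2))" for x0
    unfolding marg0_eq by (rule sum.swap)
  have "(\<Sum>x1\<in>UNIV. \<Sum>x0\<in>UNIV. \<Sum>x2\<in>UNIV. xlogx (q (x0, x1, x2)))
      = (\<Sum>x0\<in>UNIV. \<Sum>x1\<in>UNIV. \<Sum>x2\<in>UNIV. xlogx (q (x0, x1, x2)))"
    by (rule sum.swap)
  moreover have "mutual_info ?p = (\<Sum>x0\<in>UNIV. \<Sum>x2\<in>UNIV. xlogx (\<Sum>x1\<in>UNIV. q (x0, x1, x2)))
    - (\<Sum>x0\<in>UNIV. xlogx (marg0 q x0)) - (\<Sum>x2\<in>UNIV. xlogx (marg2 q x2))"
    by (subst mutual_info_eq) (auto simp: nonneg sum_nonneg * marg2_def)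
  moreover have "cond_entropy ?r = (\<Sum>x0\<in>UNIV. \<Sum>x2\<in>UNIV. xlogx (\<Sum>x1\<in>UNIV. q (x0, x1, x2)))
    - (\<Sum>x1\<in>UNIV. \<Sum>x0\<in>UNIV. \<Sum>x2\<in>UNIV. xlogx (q (x0, x1, x2)))"
    by (subst cond_entropy_eq) (auto simp: nonneg sum_UNIV_prod)
  ultimately show ?thesis
    by (simp add: ic_def sum_UNIV_prod)
qed

section \<open>Continuity along segments\<close>

lemma tendsto_ic_segment:
  assumes q: "\<And>x. q x \<ge> 0" and q': "\<And>x. q' x \<ge> 0"
  shows "((\<lambda>t. ic (\<lambda>x. (1 - t) * q x + t * q' x)) \<longlongrightarrow> ic q) (at_right 0)"
proof -
  let ?m = "\<lambda>t x. (1 - t) * q x + t * q' x"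
  \<comment> \<open>The parameter stays in the unit interval because \<open>ic_eq\<close> needs
    nonnegative entries; hence only a right-hand limit at 0 results.\<close>
  have nn: "?m t x \<ge> 0" if "t \<in> {0..1}" for t x
    using that q[of x] q'[of x] by simp
  have cont: "continuous_on {0..1} (\<lambda>t. xlogx (f t))"
    if "continuous_on {0..1} f" "\<And>t. t \<in> {0..1} \<Longrightarrow> f t \<ge> 0" for f :: "real \<Rightarrow> real"
    using that by (intro continuous_on_compose2[OF continuous_on_xlogx]) auto
  have "continuous_on {0..1} (\<lambda>t. (\<Sum>x\<in>UNIV. xlogx (?m t x))
      - (\<Sum>x0\<in>UNIV. xlogx (marg0 (?m t) x0)) - (\<Sum>x2\<in>UNIV. xlogx (marg2 (?m t) x2)))"
    unfolding marg0_def marg2_def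
    by (intro continuous_intros cont sum_nonneg nn)
  then have "continuous_on {0..1} (\<lambda>t. ic (?m t))"
    by (rule continuous_on_cong[THEN iffD1, OF refl, rotated]) (simp add: ic_eq[OF nn])
  then have "((\<lambda>t. ic (?m t)) \<longlongrightarrow> ic (?m 0)) (at 0 within {0..1})"
    by (auto simp: continuous_on_def dest: bspec[of _ _ 0])
  then show ?thesis
    by (simp add: at_within_Icc_at_right)
qed

section \<open>The linear program without the information constraint\<close>

text \<open>For positive \<alpha> these are the vertices of the polytope of nonnegative functions
  with X0-marginal \<alpha>: the pair (X1, X2) is a deterministic function of X0.\<close>

definition concentrated :: "('a \<Rightarrow> real) \<Rightarrow> ('a \<Rightarrow> 'y) \<Rightarrow> 'a \<times> 'y \<Rightarrow> real" where
  "concentrated \<alpha> m = (\<lambda>(x0, y). if y = m x0 then \<alpha> x0 else 0)"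

lemma eq_concentrated:
  assumes "marg0 q = \<alpha>" and zero: "\<And>x0 y. y \<noteq> m x0 \<Longrightarrow> q (x0, y) = 0"
  shows "q = concentrated \<alpha> m"
proof -
  have "q (x0, m x0) = \<alpha> x0" for x0
  proof -
    have "marg0 q x0 = (\<Sum>y\<in>UNIV. if y = m x0 then q (x0, m x0) else 0)"
      unfolding marg0_def by (intro sum.cong) (auto simp: zero)
    then show ?thesis using assms(1) by simp
  qed
  then show ?thesis
    using zero by (auto simp: concentrated_def)
qed

lemma marg0_concentrated: "marg0 (concentrated \<alpha> m) = \<alpha>"
  by (simp add: marg0_def concentrated_def fun_eq_iff)

text \<open>Since X0 determines the other two variables, the joint entropy equals H(X0), and
  \<open>ic\<close> reduces to the entropy of X2.\<close>

lemma ic_concentrated_nonneg: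
  fixes m :: "'a::finite \<Rightarrow> 'b::finite \<times> 'c::finite"
  assumes pos: "\<And>j. \<alpha> j \<ge> 0" and sum1: "(\<Sum>j\<in>UNIV. \<alpha> j) = 1"
  shows "ic (concentrated \<alpha> m) \<ge> 0"
proof -
  let ?q = "concentrated \<alpha> m"
  have nn: "?q x \<ge> 0" for x
    by (auto simp: concentrated_def pos split: prod.split)
  \<comment> \<open>The value 0 of \<open>xlogx\<close> at 0 lets it pass through the conditional,
    so each inner sum keeps a single term.\<close>
  have h: "xlogx (if P then a else 0) = (if P then xlogx a else 0)" for P a
    by (simp add: xlogx_def)
  have "(\<Sum>x\<in>UNIV. xlogx (?q x)) = (\<Sum>x0\<in>UNIV. xlogx (\<alpha> x0))"
    by (subst sum_UNIV_prod) (simp add: concentrated_def h)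
  then have "ic ?q = - (\<Sum>x2\<in>UNIV. xlogx (marg2 ?q x2))"
    by (simp add: ic_eq[OF nn] marg0_concentrated)
  moreover have "xlogx (marg2 ?q x2) \<le> 0" for x2
  proof (rule xlogx_nonpos)
    have nn2: "marg2 ?q y \<ge> 0" for y
      unfolding marg2_def by (intro sum_nonneg nn)
    then show "marg2 ?q x2 \<ge> 0" .
    have "marg2 ?q x2 \<le> (\<Sum>x2\<in>UNIV. marg2 ?q x2)"
      by (rule member_le_sum) (auto intro: nn2)
    also have "\<dots> = (\<Sum>x0\<in>UNIV. marg0 ?q x0)"
      by (simp only: sum_marg0 sum_marg2)
    finally show "marg2 ?q x2 \<le> 1"
      by (simp add: marg0_concentrated sum1)
  qed
  ultimately show ?thesis
    by (simp add: sum_nonpos)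
qed

text \<open>The cost excess over the concentrated law is the sum of the terms \<open>?d\<close>,
  payoff deficit times mass, all nonnegative. If the excess is not positive, every term vanishes,
  and injectivity makes the deficit nonzero off the maximiser, so the mass there is 0.\<close>

lemma linear_program_unique:
  fixes q :: "'a::finite \<times> 'b::finite \<times> 'c::finite \<Rightarrow> real"
  assumes "inj w" and max: "\<And>x0 y. w (x0, y) \<le> w (x0, m x0)"
    and nonneg: "\<And>x. q x \<ge> 0" and marg: "marg0 q = \<alpha>"
    and le: "cost w q \<le> cost w (concentrated \<alpha> m)"
  shows "q = concentrated \<alpha> m"
proof (rule eq_concentrated[OF marg])
  let ?d = "\<lambda>x0 y. (w (x0, m x0) - w (x0, y)) * q (x0, y)"
  have "(\<Sum>x0\<in>UNIV. \<Sum>y\<in>UNIV. ?d x0 y)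
      = (\<Sum>x0\<in>UNIV. w (x0, m x0) * marg0 q x0) - (\<Sum>x\<in>UNIV. q x * w x)"
    unfolding sum_UNIV_prod[of "\<lambda>x. q x * w x"] marg0_def
    by (simp add: left_diff_distrib sum_subtractf sum_distrib_left mult.commute[of "q _"])
  also have "(\<Sum>x0\<in>UNIV. w (x0, m x0) * marg0 q x0) = (\<Sum>x\<in>UNIV. concentrated \<alpha> m x * w x)"
    by (subst sum_UNIV_prod) (simp add: marg concentrated_def mult.commute
        if_distrib[of "\<lambda>z. z * _"] if_distrib[of "\<lambda>z. _ * z"] cong: if_cong)
  also have "\<dots> - (\<Sum>x\<in>UNIV. q x * w x) \<le> 0"
    using le by (simp add: cost_def)
  finally have le0: "(\<Sum>x0\<in>UNIV. \<Sum>y\<in>UNIV. ?d x0 y) \<le> 0" .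
  have d: "?d x0 y \<ge> 0" for x0 y
    using max[of x0 y] nonneg[of "(x0, y)"] by simp
  with le0 have "(\<Sum>x0\<in>UNIV. \<Sum>y\<in>UNIV. ?d x0 y) = 0"
    by (intro antisym sum_nonneg) auto
  with d have "?d x0 y = 0" for x0 y
    by (cases y) (auto simp: sum_nonneg_eq_0_iff sum_nonneg)
  moreover fix x0 y assume "y \<noteq> m x0"
  with \<open>inj w\<close> have "w (x0, m x0) \<noteq> w (x0, y)"
    by (auto dest: injD)
  ultimately show "q (x0, y) = 0"
    by (metis eq_iff_diff_eq_0 mult_eq_0_iff)
qed

text \<open>A slack information constraint stays slack on a short initial piece of the segment
  towards \<open>q'\<close>. Optimality applies there, and linearity of the cost carries the
  comparison to the endpoint.\<close>

lemma optimal_unconstrained: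
  fixes q :: "'a::finite \<times> 'b::finite \<times> 'c::finite \<Rightarrow> real"
  assumes opt: "optimal \<alpha> w q" and ic: "ic q < 0"
    and q': "\<And>x. q' x \<ge> 0" "marg0 q' = \<alpha>"
  shows "cost w q \<le> cost w q'"
proof -
  let ?m = "\<lambda>t x. (1 - t) * q x + t * q' x"
  have feas: "feasible \<alpha> q" and min: "\<And>r. feasible \<alpha> r \<Longrightarrow> cost w q \<le> cost w r"
    using opt by (auto simp: optimal_def is_arg_min_linorder)
  then have q: "marg0 q = \<alpha>" "\<And>x. q x \<ge> 0" "(\<Sum>x\<in>UNIV. q x) = 1"
    by (auto simp: feasible_iff)
  have "eventually (\<lambda>t. ic (?m t) < 0) (at_right 0)"
    using tendsto_ic_segment[of q q'] q q' ic by (auto dest: order_tendstoD)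
  moreover have "eventually (\<lambda>t::real. t \<in> {0<..<1}) (at_right 0)"
    by (rule eventually_at_right_real) simp
  ultimately have "eventually (\<lambda>t. ic (?m t) < 0 \<and> t \<in> {0<..<1}) (at_right 0)"
    by (rule eventually_conj)
  then obtain t :: real where t: "ic (?m t) < 0" "0 < t" "t < 1"
    using eventually_happens trivial_limit_at_right_real[of "0 :: real"] by fastforce
  have "marg0 (?m t) x0 = (1 - t) * marg0 q x0 + t * marg0 q' x0" for x0
    by (simp add: marg0_def sum.distrib sum_distrib_left)
  then have m0: "marg0 (?m t) = \<alpha>"
    by (simp add: fun_eq_iff q q' algebra_simps)
  \<comment> \<open>The total mass is determined by the X0-marginal, which the mixture shares with
    \<open>q\<close>.\<close>
  moreover have "(\<Sum>x\<in>UNIV. ?m t x) = 1"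
    using q(3) by (metis m0 q(1) sum_marg0)
  ultimately have "feasible \<alpha> (?m t)"
    using t q q' by (simp add: feasible_iff)
  then have "cost w q \<le> cost w (?m t)" by (rule min)
  also have "cost w (?m t) = (1 - t) * cost w q + t * cost w q'"
    by (simp add: cost_def distrib_right sum.distrib sum_distrib_left mult.assoc)
  finally have "t * cost w q \<le> t * cost w q'"
    by (simp add: algebra_simps)
  with \<open>0 < t\<close> show ?thesis by simp
qed

section \<open>Infinite slope of \<open>ic\<close> at triples of mass 0\<close>

text \<open>The difference quotient at 0 is \<open>log 2 t\<close>, which tends to minus
  infinity.\<close>

lemma not_differentiable_xlogx: "\<not> xlogx differentiable (at 0 within {0..})"
proof
  assume "xlogx differentiable (at 0 within {0..})"
  then obtain D where "(xlogx has_real_derivative D) (at 0 within {0..})"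
    by (auto simp: real_differentiable_def)
  then have "((\<lambda>t. xlogx t / t) \<longlongrightarrow> D) (at_right 0)"
    by (simp add: has_field_derivative_iff at_within_Ici_at_right xlogx_def)
  moreover have "filterlim (\<lambda>t. xlogx t / t) at_bot (at_right 0)"
    unfolding xlogx_def by real_asymp
  ultimately show False
    using not_tendsto_and_filterlim_at_infinity[of "at_right 0"] filterlim_at_bot_imp_at_infinity
    by (metis trivial_limit_at_right_real)
qed

lemma xlogx_differentiable_shift:
  assumes "a > 0"
  shows "(\<lambda>t. xlogx (a + t)) differentiable (at 0 within S)"
proof -
  have "((\<lambda>t. (a + t) * log 2 (a + t)) has_real_derivative (log 2 a + 1 / ln 2)) (at 0)"
    using assms by (auto intro!: derivative_eq_intros simp: log_def add_divide_distrib)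
  then show ?thesis
    unfolding xlogx_def real_differentiable_def
    using has_field_derivative_at_within by blast
qed

text \<open>Because the old entry is 0, overwriting it with \<open>t\<close> amounts to adding
  \<open>t\<close>, so the sum splits into the old marginal and a correction.\<close>

lemma marg0_upd:
  assumes "q (a, b, c) = 0"
  shows "marg0 (q((a, b, c) := t)) x0 = (if x0 = a then marg0 q a + t else marg0 q x0)"
proof -
  have "marg0 (q((a, b, c) := t)) x0
      = (\<Sum>y\<in>UNIV. q (x0, y) + (if y = (b, c) then if x0 = a then t else 0 else 0))"
    unfolding marg0_def using assms by (intro sum.cong) auto
  then show ?thesis
    by (simp only: sum.distrib) (simp add: marg0_def)
qed

lemma marg2_upd:
  assumes "q (a, b, c) = 0"
  shows "marg2 (q((a, b, c) := t)) x2 = (if x2 = c then marg2 q c + t else marg2 q x2)"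
proof -
  have "marg2 (q((a, b, c) := t)) x2
      = (\<Sum>x0\<in>UNIV. \<Sum>x1\<in>UNIV. q (x0, x1, x2)
          + (if x1 = b then if x0 = a then if x2 = c then t else 0 else 0 else 0))"
    unfolding marg2_def using assms by (intro sum.cong) auto
  then show ?thesis
    by (simp only: sum.distrib) (simp add: marg2_def)
qed

lemma sum_xlogx_upd:
  fixes g :: "'x::finite \<Rightarrow> real"
  shows "(\<Sum>x\<in>UNIV. xlogx (if x = a then s else g x)) = xlogx s + (\<Sum>x\<in>UNIV - {a}. xlogx (g x))"
  by (subst sum.remove[of UNIV a]) auto

text \<open>The two marginal terms that vary are evaluated near positive numbers and are smooth
  there. The singular term \<open>xlogx t\<close> has nothing to cancel it.\<close>

lemma ic_not_differentiable:
  fixes q :: "'a::finite \<times> 'b::finite \<times> 'c::finite \<Rightarrow> real"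
  assumes nonneg: "\<And>x. q x \<ge> 0" and zero: "q (a, b, c) = 0"
    and m0: "marg0 q a > 0" and m2: "marg2 q c > 0"
  shows "\<not> (\<lambda>t. ic (q((a, b, c) := t))) differentiable (at 0 within {0..})"
proof
  let ?f = "\<lambda>t. ic (q((a, b, c) := t))"
  assume f: "?f differentiable (at 0 within {0..})"
  define C where "C = (\<Sum>x\<in>UNIV - {a}. xlogx (marg0 q x)) + (\<Sum>x\<in>UNIV - {c}. xlogx (marg2 q x))
    - (\<Sum>x\<in>UNIV - {(a, b, c)}. xlogx (q x))"
  \<comment> \<open>Solved for \<open>xlogx t\<close>, with the unaffected terms collected in
    \<open>C\<close>: differentiability of \<open>?f\<close> would pass to
    \<open>xlogx\<close>.\<close>
  have eq: "?f t + xlogx (marg0 q a + t) + xlogx (marg2 q c + t) + C = xlogx t" if "t \<ge> 0" for t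
  proof -
    have "q((a, b, c) := t) = (\<lambda>x. if x = (a, b, c) then t else q x)"
      by auto
    then have "(\<Sum>x\<in>UNIV. xlogx ((q((a, b, c) := t)) x))
        = xlogx t + (\<Sum>x\<in>UNIV - {(a, b, c)}. xlogx (q x))"
      by (simp only: sum_xlogx_upd)
    moreover have "ic (q((a, b, c) := t)) = (\<Sum>x\<in>UNIV. xlogx ((q((a, b, c) := t)) x))
      - (\<Sum>x0\<in>UNIV. xlogx (marg0 (q((a, b, c) := t)) x0))
      - (\<Sum>x2\<in>UNIV. xlogx (marg2 (q((a, b, c) := t)) x2))"
      by (rule ic_eq) (use that nonneg in auto)
    ultimately show ?thesis
      by (simp add: marg0_upd[of q a b c, OF zero] marg2_upd[of q a b c, OF zero] sum_xlogx_upd C_def)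
  qed
  have "(\<lambda>t. ?f t + xlogx (marg0 q a + t) + xlogx (marg2 q c + t) + C)
      differentiable (at 0 within {0..})"
    by (intro differentiable_add f xlogx_differentiable_shift m0 m2 differentiable_const)
  then obtain D where
    "((\<lambda>t. ?f t + xlogx (marg0 q a + t) + xlogx (marg2 q c + t) + C) has_real_derivative D)
      (at 0 within {0..})"
    by (auto simp: real_differentiable_def)
  then have "(xlogx has_real_derivative D) (at 0 within {0..})"
    by (rule has_field_derivative_transform_within[of _ _ _ _ 1]) (auto simp: eq)
  then show False
    using not_differentiable_xlogx by (auto simp: real_differentiable_def)
qed

section \<open>Stationarity with zero information multiplier\<close>

text \<open>Without the term in \<open>ic\<close> the Lagrangian is affine in \<open>q\<close>, so
  stationarity says that each coefficient is 0.\<close>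

lemma kkt_linear:
  fixes q :: "'a::finite \<times> 'b::finite \<times> 'c::finite \<Rightarrow> real"
  assumes kkt: "kkt \<alpha> w q l \<mu>0 \<mu> 0" and nonneg: "\<And>x. q x \<ge> 0"
  shows "w (a, y) + l (a, y) = \<mu>0 + \<mu> a"
proof -
  obtain b c where y: "y = (b, c)" by (cases y)
  let ?x = "(a, b, c)"
  let ?L = "\<lambda>r. \<Sum>x\<in>UNIV. (\<mu>0 + \<mu> (fst x) - w x - l x) * r x"
  have lag: "lagrangian \<alpha> w l \<mu>0 \<mu> 0 r = ?L r - \<mu>0 - (\<Sum>x0\<in>UNIV. \<mu> x0 * \<alpha> x0)" for r
  proof -
    have "(\<Sum>x0\<in>UNIV. \<mu> x0 * (marg0 r x0 - \<alpha> x0))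
        = (\<Sum>x\<in>UNIV. \<mu> (fst x) * r x) - (\<Sum>x0\<in>UNIV. \<mu> x0 * \<alpha> x0)"
      by (simp add: sum_UNIV_prod[of "\<lambda>x. \<mu> (fst x) * r x"] marg0_def right_diff_distrib
          sum_subtractf sum_distrib_left)
    then show ?thesis
      by (simp add: lagrangian_def algebra_simps sum.distrib sum_subtractf sum_distrib_left
          flip: marg0_eq)
  qed
  define d where "d = \<mu>0 + \<mu> a - w ?x - l ?x"
  have "?L (q(?x := t)) = d * t + (\<Sum>x\<in>UNIV - {?x}. (\<mu>0 + \<mu> (fst x) - w x - l x) * q x)" for t
    by (subst sum.remove[of UNIV ?x]) (auto simp: d_def)
  then have "((\<lambda>t. lagrangian \<alpha> w l \<mu>0 \<mu> 0 (q(?x := t))) has_real_derivative d) (at (q ?x))"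
    unfolding lag by (auto intro!: derivative_eq_intros)
  \<comment> \<open>Passing to right-hand derivatives treats zero and positive \<open>q ?x\<close>
    alike: the right neighbourhood always lies in the domain, and limits along it are
    unique.\<close>
  then have "((\<lambda>t. lagrangian \<alpha> w l \<mu>0 \<mu> 0 (q(?x := t))) has_real_derivative d) (at_right (q ?x))"
    by (rule has_field_derivative_at_within)
  moreover have "((\<lambda>t. lagrangian \<alpha> w l \<mu>0 \<mu> 0 (q(?x := t))) has_real_derivative 0)
      (at_right (q ?x))"
  proof (rule DERIV_subset)
    show "((\<lambda>t. lagrangian \<alpha> w l \<mu>0 \<mu> 0 (q(?x := t))) has_real_derivative 0)
      (at (q ?x) within {0..})"
      using kkt by (simp only: kkt_def)
    show "{q ?x<..} \<subseteq> {0..}"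
      using nonneg[of ?x] by auto
  qed
  ultimately have "d = 0"
    unfolding has_field_derivative_iff
    by (rule tendsto_unique[OF trivial_limit_at_right_real])
  then show ?thesis
    by (simp add: d_def y)
qed

text \<open>For fixed \<open>x0\<close> the sum \<open>w + l\<close> is constant, so a smaller
  payoff forces a positive multiplier, and complementary slackness removes the mass.\<close>

lemma kkt_linear_concentrated:
  fixes q :: "'a::finite \<times> 'b::finite \<times> 'c::finite \<Rightarrow> real"
  assumes kkt: "kkt \<alpha> w q l \<mu>0 \<mu> 0" and nonneg: "\<And>x. q x \<ge> 0" and marg: "marg0 q = \<alpha>"
    and "inj w" and max: "\<And>x0 y. w (x0, y) \<le> w (x0, m x0)"
  shows "q = concentrated \<alpha> m"
proof (rule eq_concentrated[OF marg])
  fix x0 y assume "y \<noteq> m x0"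
  with \<open>inj w\<close> max[of x0 y] have "w (x0, y) < w (x0, m x0)"
    by (metis injD order_le_less prod.inject)
  moreover have "w (x0, y) + l (x0, y) = w (x0, m x0) + l (x0, m x0)"
    using kkt_linear[OF kkt nonneg] by simp
  moreover have "l (x0, m x0) \<ge> 0" "l (x0, y) * q (x0, y) = 0"
    using kkt by (auto simp only: kkt_def)
  ultimately show "q (x0, y) = 0"
    by auto
qed

section \<open>Activity of the information constraint\<close>

text \<open>The assumption \<open>nondegenerate\<close> excludes the case where X1 has a single
  value and one \<open>x2\<close> is best for every \<open>x0\<close>. There the linear program is
  solved by a law with constant X2; it has \<open>ic\<close> equal to 0, so it is feasible, and it
  satisfies the conditions with multiplier 0.\<close>

theorem proposition2:
  fixes \<alpha> :: "'a::finite \<Rightarrow> real"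
    and w q :: "'a \<times> 'b::finite \<times> 'c::finite \<Rightarrow> real"
  assumes alpha_pos: "\<And>j. \<alpha> j > 0"
    and alpha_sum: "(\<Sum>j\<in>UNIV. \<alpha> j) = 1"
    and distinct: "inj w"
    and nondegenerate: "CARD('b) \<ge> 2 \<or>
      \<not> (\<exists>x2. \<forall>x0. \<exists>x1. \<forall>y1 y2. w (x0, y1, y2) \<le> w (x0, x1, x2))"
    and opt: "optimal \<alpha> w q"
  shows "ic q = 0 \<and> (\<forall>l \<mu>0 \<mu> l_ic. kkt \<alpha> w q l \<mu>0 \<mu> l_ic \<longrightarrow> l_ic > 0)"
proof (intro conjI allI impI)
  have feas: "feasible \<alpha> q"
    using opt by (auto simp: optimal_def is_arg_min_linorder)
  then have q: "marg0 q = \<alpha>" "\<And>x. q x \<ge> 0" "ic q \<le> 0"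
    by (auto simp: feasible_iff)
  have "\<exists>y. \<forall>z. w (x0, z) \<le> w (x0, y)" for x0
  proof -
    have "(MAX y. w (x0, y)) \<in> range (\<lambda>y. w (x0, y))"
      by (intro Max_in) auto
    then obtain y where "(MAX y. w (x0, y)) = w (x0, y)" by blast
    moreover have "w (x0, z) \<le> (MAX y. w (x0, y))" for z
      by (intro Max_ge) auto
    ultimately show ?thesis by metis
  qed
  then obtain m where max: "\<And>x0 z. w (x0, z) \<le> w (x0, m x0)"
    by metis
  let ?q = "concentrated \<alpha> m"
  show "ic q = 0"
  proof (rule ccontr)
    assume "ic q \<noteq> 0"
    with q have neg: "ic q < 0" by simp
    have "?q x \<ge> 0" for x
      using alpha_pos by (auto simp: concentrated_def less_imp_le split: prod.split)
    then have "cost w q \<le> cost w ?q"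
      by (rule optimal_unconstrained[OF opt neg _ marg0_concentrated])
    then have "q = ?q"
      by (rule linear_program_unique[OF distinct max q(2,1)])
    with ic_concentrated_nonneg[of \<alpha> m] alpha_pos alpha_sum neg show False
      by (simp add: less_imp_le)
  qed
  fix l \<mu>0 \<mu> l_ic
  assume kkt: "kkt \<alpha> w q l \<mu>0 \<mu> l_ic"
  show "l_ic > 0"
  proof (rule ccontr)
    assume "\<not> l_ic > 0"
    with kkt have "l_ic = 0"
      by (auto simp only: kkt_def)
    with kkt have q_eq: "q = ?q"
      using kkt_linear_concentrated q distinct max by metis
    \<comment> \<open>Any state serves: the X2-value \<open>c\<close> of its maximiser carries
      positive mass.\<close>
    fix x0 :: 'a
    obtain b c where m: "m x0 = (b, c)" by (cases "m x0")
    \<comment> \<open>Sought is a triple with X2-value \<open>c\<close> that is not a maximiser.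
      With two values of X1, change \<open>b\<close> at \<open>x0\<close>; otherwise some state has
      its maximiser at another X2-value, as \<open>c\<close> would else be best for all
      states.\<close>
    have "\<exists>a b'. m a \<noteq> (b', c)"
      using nondegenerate
    proof
      assume "CARD('b) \<ge> 2"
      then have "\<not> CARD('b) \<le> Suc 0" by simp
      then obtain b' where "b' \<noteq> b"
        by (metis UNIV_I card_le_Suc0_iff_eq finite)
      with m show ?thesis by (intro exI[of _ x0] exI[of _ b']) simp
    next
      assume "\<not> (\<exists>x2. \<forall>x0. \<exists>x1. \<forall>y1 y2. w (x0, y1, y2) \<le> w (x0, x1, x2))"
      then show ?thesis
        by (metis max)
    qed
    then obtain a b' where "m a \<noteq> (b', c)" by blast
    then have zero: "q (a, b', c) = 0"
      by (subst q_eq) (auto simp: concentrated_def)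
    have "0 < q (x0, b, c)"
      by (subst q_eq) (simp add: concentrated_def m alpha_pos)
    also have "\<dots> \<le> (\<Sum>x1\<in>UNIV. q (x0, x1, c))"
      by (rule member_le_sum[of b UNIV "\<lambda>x1. q (x0, x1, c)"]) (auto simp: q)
    also have "\<dots> \<le> marg2 q c"
      unfolding marg2_def
      by (rule member_le_sum[of x0 UNIV "\<lambda>x0. \<Sum>x1\<in>UNIV. q (x0, x1, c)"])
        (auto simp: q intro: sum_nonneg)
    finally have "marg2 q c > 0" .
    then have "\<not> (\<lambda>t. ic (q((a, b', c) := t))) differentiable (at 0 within {0..})"
      by (intro ic_not_differentiable zero q) (simp_all add: q alpha_pos)
    \<comment> \<open>With \<open>l_ic = 0\<close> stationarity no longer sees \<open>ic\<close>;
      the contradiction comes from the differentiability clause of \<open>kkt\<close>.\<close>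
    moreover have "(\<lambda>t. ic (q((a, b', c) := t))) differentiable (at (q (a, b', c)) within {0..})"
      using kkt by (simp only: kkt_def)
    ultimately show False
      by (simp add: zero)
  qed
qed

end
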